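(* Let $q\in(1,\infty)$, $K\in[1,\infty)$ and suppose $f_i:\mathbb R\to\mathbb R$, $i\in\mathbb N$, are $K$-Lipschitz continuous with $|f_i(0)|\le K$. Define $g_d:\mathbb R^d\to\mathbb R$ by $g_d(x)=\sum_{i=1}^d f_i(x_i)$. Then for all $d\in\mathbb N$ and $\varepsilon\in(0,1]$, there exists $\phi\in\mathcal N$ with $\mathcal R_{\mathrm{ReLU}}^\phi\in C(\mathbb R^d,\mathbb R)$ such that 1) $\sup_{x\in\mathbb R^d}(1+\|x\|^q)^{-1}|g_d(x)-\mathcal R_{\mathrm{ReLU}}^\phi(x)|\le\varepsilon$, 2) $\mathcal R_{\mathrm{ReLU}}^\phi$ is $\sqrt d\,K$-Lipschitz continuous on $\mathbb R^d$, and 3) $\mathcal P(\phi)\le\tfrac29\,10^3\,2^{3t(q+1)}\,K^{2t(q+1)}\,d^{\,t(q+1)+4}\,\varepsilon^{-t}$ for $t=\frac{q}{q-1}$.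
   Context: $\mathbb N=\{1,2,\dots\}$; $\|\cdot\|$ is the Euclidean norm, and Lipschitz continuity is with respect to it. A skeleton is $\phi=[(V_1,b_1),\dots,(V_D,b_D)]$ with $D\in\mathbb N$, $l_0,\dots,l_D\in\mathbb N$, $V_k\in\mathbb R^{l_k\times l_{k-1}}$, $b_k\in\mathbb R^{l_k}$. $\mathcal N$ is the set of all skeletons, and the number of parameters is $\mathcal P(\phi)=\sum_{k=1}^D l_k(l_{k-1}+1)$. With $\mathrm{ReLU}(x)=\max\{x,0\}$ applied componentwise, the ReLU-realization is $\mathcal R_{\mathrm{ReLU}}^\phi=A_D\circ\mathrm{ReLU}\circ A_{D-1}\circ\cdots\circ\mathrm{ReLU}\circ A_1\in C(\mathbb R^{l_0},\mathbb R^{l_D})$ with $A_k(x)=V_kx+b_k$. *)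

theory Defs
  imports
    "HOL-Analysis.L2_Norm"
    "HOL-Analysis.Lipschitz"
    "HOL-Library.Extended_Real"
    "Jordan_Normal_Form.Matrix"
begin

(* '$' shall only mean Jordan_Normal_Form's vec_index *)
unbundle no vec_syntax

text \<open>Vectors in $R^d$ with varying \<open>d\<close> are elements of \<open>carrier_vec d\<close>; their
  coordinates are indexed from 0, whereas layers and families of functions are indexed from 1 in
  the mathematics.\<close>

definition eucl_norm :: "real vec \<Rightarrow> real" where
  "eucl_norm x = L2_set (\<lambda>i. x $ i) {0..<dim_vec x}"

definition eucl_lipschitz :: "real \<Rightarrow> nat \<Rightarrow> (real vec \<Rightarrow> real) \<Rightarrow> bool" where
  "eucl_lipschitz L d F \<longleftrightarrow>
     0 \<le> L \<and> (\<forall>x\<in>carrier_vec d. \<forall>y\<in>carrier_vec d. \<bar>F x - F y\<bar> \<le> L * eucl_norm (x - y))"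

type_synonym layers = "(real mat \<times> real vec) list"

text \<open>The dimensions $l_0, \dots, l_D$ are read off from the matrices: the \<open>k\<close>-th entry
  (counted from 1) has an $l_k \times l_{k-1}$ matrix.\<close>

definition skeletons :: "layers set" where
  "skeletons = {\<phi>. \<phi> \<noteq> [] \<and>
     (\<forall>(V, b)\<in>set \<phi>. dim_row V \<ge> 1 \<and> dim_col V \<ge> 1 \<and> dim_vec b = dim_row V) \<and>
     successively (\<lambda>(V, b) (W, c). dim_col W = dim_row V) \<phi>}"

definition in_dim :: "layers \<Rightarrow> nat" where
  "in_dim \<phi> = dim_col (fst (hd \<phi>))"

definition out_dim :: "layers \<Rightarrow> nat" where
  "out_dim \<phi> = dim_row (fst (last \<phi>))"

definition num_params :: "layers \<Rightarrow> nat" where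
  "num_params \<phi> = (\<Sum>(V, b)\<leftarrow>\<phi>. dim_row V * (dim_col V + 1))"

definition ReLU :: "real \<Rightarrow> real" where
  "ReLU x = max x 0"

text \<open>No activation is applied after the last affine map. The clause for the empty list is only
  there for totality; the empty list is not a skeleton.\<close>

fun realization :: "(real \<Rightarrow> real) \<Rightarrow> layers \<Rightarrow> real vec \<Rightarrow> real vec" where
  "realization \<rho> [] x = x"
| "realization \<rho> [(V, b)] x = V *\<^sub>v x + b"
| "realization \<rho> ((V, b) # l # \<phi>) x = realization \<rho> (l # \<phi>) (map_vec \<rho> (V *\<^sub>v x + b))"

lemma realization_in_carrier:
  assumes "\<phi> \<in> skeletons" "x \<in> carrier_vec (in_dim \<phi>)"
  shows "realization \<rho> \<phi> x \<in> carrier_vec (out_dim \<phi>)"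
  using assms
proof (induction \<rho> \<phi> x rule: realization.induct)
  case (1 \<rho> x)
  then show ?case by (simp add: skeletons_def)
next
  case (2 \<rho> V b x)
  then have "dim_vec b = dim_row V"
    by (simp add: skeletons_def)
  then show ?case
    by (intro carrier_vecI) (simp add: out_dim_def)
next
  case (3 \<rho> V b l \<phi> x)
  have "l # \<phi> \<in> skeletons" "dim_vec b = dim_col (fst l)"
    using "3.prems"(1) by (auto simp: skeletons_def)
  moreover from this have "map_vec \<rho> (V *\<^sub>v x + b) \<in> carrier_vec (in_dim (l # \<phi>))"
    by (intro carrier_vecI) (simp add: in_dim_def)
  ultimately have "realization \<rho> (l # \<phi>) (map_vec \<rho> (V *\<^sub>v x + b)) \<in> carrier_vec (out_dim (l # \<phi>))"
    using "3.IH" by blast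
  then show ?case
    by (simp only: realization.simps out_dim_def last.simps list.distinct if_False)
qed

definition coord_sum :: "(nat \<Rightarrow> real \<Rightarrow> real) \<Rightarrow> nat \<Rightarrow> real vec \<Rightarrow> real" where
  "coord_sum f d x = (\<Sum>i = 1..d. f i (x $ (i - 1)))"

end

theory Submission
  imports Defs
begin

text \<open>A single hidden layer suffices. Put $B = 2Kd/\varepsilon$, $R = B^{1/(q-1)}$, and replace
  each $f_i$ by its piecewise linear interpolant on an equidistant grid of $[-R,R]$ with
  $N = \lceil 2B^t \rceil$ intervals, extended by constants. The interpolant is again $K$-Lipschitz
  and agrees with $f_i$ on the grid, so the error at $y$ is at most $2K$ times the distance of $y$
  to the grid. For $|y| \le R$ this is at most $2K \cdot 2R/N \le \varepsilon/d$; for $|y| > R$ it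
  is at most $2K|y| \le (\varepsilon/d)\,|y|^q$, because $|y|^{q-1} \ge B$.\<close>

section \<open>Piecewise linear interpolation on an equidistant grid\<close>

definition interpolant :: "(real \<Rightarrow> real) \<Rightarrow> real \<Rightarrow> real \<Rightarrow> nat \<Rightarrow> real \<Rightarrow> real" where
  "interpolant f a \<delta> N y = f a +
     (\<Sum>j<N. (f (a + real (Suc j) * \<delta>) - f (a + real j * \<delta>)) / \<delta> *
       (ReLU (y - (a + real j * \<delta>)) - ReLU (y - (a + real (Suc j) * \<delta>))))"

text \<open>Each summand of \<open>interpolant\<close> is a slope times a ramp, a difference of two
  ReLUs that is 0 left of its grid interval and constantly \<delta> right of it. At grid point
  \<open>k\<close> the ramps with \<open>j < k\<close> are complete and contribute the full
  increment of \<open>f\<close>, the others vanish, and the increments telescope.\<close>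

lemma interpolant_grid:
  assumes "\<delta> > 0" "k \<le> N"
  shows "interpolant f a \<delta> N (a + real k * \<delta>) = f (a + real k * \<delta>)"
proof -
  let ?u = "\<lambda>j. f (a + real j * \<delta>)"
  have hat: "(?u (Suc j) - ?u j) / \<delta> *
      (ReLU (a + real k * \<delta> - (a + real j * \<delta>)) - ReLU (a + real k * \<delta> - (a + real (Suc j) * \<delta>)))
      = (if j < k then ?u (Suc j) - ?u j else 0)" for j
  proof (cases "j < k")
    case True
    then have "real j + 1 \<le> real k" by linarith
    then have "(real j + 1) * \<delta> \<le> real k * \<delta>"
      using assms(1) by (intro mult_right_mono) auto
    then have "ReLU (a + real k * \<delta> - (a + real j * \<delta>))
        - ReLU (a + real k * \<delta> - (a + real (Suc j) * \<delta>)) = \<delta>"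
      using assms(1) by (simp add: ReLU_def algebra_simps)
    then show ?thesis
      using True assms(1) by simp
  next
    case False
    then have "real k * \<delta> \<le> real j * \<delta>" "real k * \<delta> \<le> real (Suc j) * \<delta>"
      using assms(1) by (auto intro!: mult_right_mono)
    then have "ReLU (a + real k * \<delta> - (a + real j * \<delta>)) = 0"
      "ReLU (a + real k * \<delta> - (a + real (Suc j) * \<delta>)) = 0"
      by (simp_all add: ReLU_def del: of_nat_Suc)
    then show ?thesis
      using False by simp
  qed
  have "interpolant f a \<delta> N (a + real k * \<delta>)
      = f a + (\<Sum>j<N. if j < k then ?u (Suc j) - ?u j else 0)"
    unfolding interpolant_def hat ..
  also have "(\<Sum>j<N. if j < k then ?u (Suc j) - ?u j else 0) = (\<Sum>j<k. ?u (Suc j) - ?u j)"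
    using assms(2) by (intro sum.mono_neutral_cong_right) auto
  also have "\<dots> = ?u k - ?u 0"
    by (rule sum_lessThan_telescope)
  finally show ?thesis by simp
qed

text \<open>All ramps are nondecreasing and all slopes are bounded by \<open>K\<close>, so the
  increment is at most \<open>K\<close> times the sum of the ramp increments. That sum telescopes,
  which avoids distinguishing the cells containing \<open>y\<close> and \<open>z\<close>.\<close>

lemma interpolant_lipschitz:
  assumes "\<delta> > 0" "K-lipschitz_on UNIV f"
  shows "\<bar>interpolant f a \<delta> N y - interpolant f a \<delta> N z\<bar> \<le> K * \<bar>y - z\<bar>"
proof (induction z y rule: linorder_wlog)
  case (le z y)
  let ?c = "\<lambda>y j. ReLU (y - (a + real j * \<delta>))"
  let ?s = "\<lambda>j. (f (a + real (Suc j) * \<delta>) - f (a + real j * \<delta>)) / \<delta>"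
  let ?D = "\<lambda>j. (?c y j - ?c y (Suc j)) - (?c z j - ?c z (Suc j))"
  have K: "0 \<le> K" using assms(2) by (rule lipschitz_on_nonneg)
  have slope: "\<bar>?s j\<bar> \<le> K" for j
  proof -
    have "\<bar>f (a + real (Suc j) * \<delta>) - f (a + real j * \<delta>)\<bar> \<le> K * \<delta>"
      using lipschitz_onD[OF assms(2), of "a + real (Suc j) * \<delta>" "a + real j * \<delta>"] assms(1)
      by (simp add: dist_real_def algebra_simps)
    then show ?thesis using assms(1) by (simp add: abs_divide pos_divide_le_eq)
  qed
  have D_nonneg: "0 \<le> ?D j" for j
    using le assms(1) by (simp add: ReLU_def max_def algebra_simps)
  have "interpolant f a \<delta> N y - interpolant f a \<delta> N z = (\<Sum>j<N. ?s j * ?D j)"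
    unfolding interpolant_def by (simp add: sum_subtractf right_diff_distrib)
  then have "\<bar>interpolant f a \<delta> N y - interpolant f a \<delta> N z\<bar> \<le> (\<Sum>j<N. \<bar>?s j * ?D j\<bar>)"
    by (simp only: sum_abs)
  also have "\<dots> \<le> (\<Sum>j<N. K * ?D j)"
    unfolding abs_mult using slope D_nonneg
    by (intro sum_mono mult_mono) (auto simp: K)
  also have "\<dots> = K * (\<Sum>j<N. (?c y j - ?c z j) - (?c y (Suc j) - ?c z (Suc j)))"
    unfolding sum_distrib_left by (intro sum.cong) (auto simp: algebra_simps)
  also have "\<dots> = K * ((?c y 0 - ?c z 0) - (?c y N - ?c z N))"
    unfolding sum_lessThan_telescope'[of "\<lambda>j. ?c y j - ?c z j"] ..
  \<comment> \<open>For z \<le> y, the first difference is at most y - z and the second one is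
    nonnegative, because ReLU is 1-Lipschitz and monotone.\<close>
  also have "\<dots> \<le> K * \<bar>y - z\<bar>"
    using K le by (intro mult_left_mono) (auto simp: ReLU_def)
  finally show ?case .
next
  case (sym z y)
  then show ?case by (simp add: abs_minus_commute)
qed

text \<open>The grid point is arbitrary and \<open>y\<close> may lie outside the grid, so this one
  estimate serves both the inner and the outer region below.\<close>

lemma interpolant_error:
  assumes "\<delta> > 0" "K-lipschitz_on UNIV f" "k \<le> N"
  shows "\<bar>f y - interpolant f a \<delta> N y\<bar> \<le> 2 * K * \<bar>y - (a + real k * \<delta>)\<bar>"
proof -
  let ?t = "a + real k * \<delta>"
  have "\<bar>f y - f ?t\<bar> \<le> K * \<bar>y - ?t\<bar>"
    using lipschitz_onD[OF assms(2), of y ?t] by (simp add: dist_real_def)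
  moreover have "\<bar>interpolant f a \<delta> N y - f ?t\<bar> \<le> K * \<bar>y - ?t\<bar>"
    using interpolant_lipschitz[OF assms(1,2), of a N y ?t] interpolant_grid[OF assms(1,3)] by simp
  ultimately show ?thesis by linarith
qed

text \<open>The bound on \<open>N\<close> says that the mesh width is at most 1/B, which settles
  [-R,R]. The choice of \<open>R\<close> means R^(q-1) = B, so that outside this interval the weight
  dominates the linearly growing error.\<close>

lemma interpolant_error_weighted:
  assumes "1 < q" "0 < B" "0 < N" "K-lipschitz_on UNIV f"
    and R: "R = B powr (1 / (q - 1))" and N: "2 * R * B \<le> real N"
  shows "\<bar>f y - interpolant f (- R) (2 * R / real N) N y\<bar> \<le> 2 * K / B * (1 + \<bar>y\<bar> powr q)"
proof -
  let ?\<delta> = "2 * R / real N"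
  have "R > 0" using R assms(2) by simp
  then have d: "?\<delta> > 0" using assms(3) by simp
  have K: "0 \<le> K" using assms(4) by (rule lipschitz_on_nonneg)
  have err: "\<bar>f y - interpolant f (- R) ?\<delta> N y\<bar> \<le> 2 * K * \<bar>y - (- R + real k * ?\<delta>)\<bar>"
    if "k \<le> N" for k
    using interpolant_error[OF d assms(4) that] .
  have pw: "0 \<le> \<bar>y\<bar> powr q" by simp
  show ?thesis
  proof (cases "\<bar>y\<bar> \<le> R")
    case True
    \<comment> \<open>The left end of the cell containing \<open>y\<close>; at y = R this is the
      last grid point, \<open>k = N\<close>.\<close>
    define k where "k = nat \<lfloor>(y + R) / ?\<delta>\<rfloor>"
    have nn: "0 \<le> (y + R) / ?\<delta>" using True d by auto
    have "(y + R) / ?\<delta> \<le> real N"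
      using True \<open>R > 0\<close> assms(3) by (simp add: field_simps)
    then have "k \<le> N" unfolding k_def by linarith
    have "real k \<le> (y + R) / ?\<delta>" "(y + R) / ?\<delta> < real k + 1"
      unfolding k_def using nn by linarith+
    then have "real k * ?\<delta> \<le> y + R" "y + R < (real k + 1) * ?\<delta>"
      using pos_le_divide_eq[OF d, of "real k" "y + R"] pos_divide_less_eq[OF d, of "y + R" "real k + 1"]
      by blast+
    then have "\<bar>y - (- R + real k * ?\<delta>)\<bar> \<le> ?\<delta>"
      unfolding distrib_right by linarith
    also have "?\<delta> \<le> 1 / B"
      using N assms(2,3) by (simp add: field_simps)
    finally have "2 * K * \<bar>y - (- R + real k * ?\<delta>)\<bar> \<le> 2 * K * (1 / B)"
      using K by (intro mult_left_mono) auto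
    also have "\<dots> \<le> 2 * K * (1 / B) * (1 + \<bar>y\<bar> powr q)"
      using K assms(2) pw mult_left_mono[of 1 "1 + \<bar>y\<bar> powr q" "2 * K * (1 / B)"] by simp
    finally show ?thesis using err[OF \<open>k \<le> N\<close>] by simp
  next
    case False
    \<comment> \<open>Compare with the end of the grid on the same side as \<open>y\<close>: index 0
      is -R and index \<open>N\<close> is R. Since |y| > R, the distance to it is less than
      |y|.\<close>
    have err_abs: "\<bar>f y - interpolant f (- R) ?\<delta> N y\<bar> \<le> 2 * K * \<bar>y\<bar>"
    proof (cases "y < 0")
      case True
      have "2 * K * \<bar>y - (- R + real 0 * ?\<delta>)\<bar> \<le> 2 * K * \<bar>y\<bar>"
        using True False K \<open>R > 0\<close> by (intro mult_left_mono) auto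
      then show ?thesis using err[of 0] by linarith
    next
      case nneg: False
      have "2 * K * \<bar>y - (- R + real N * ?\<delta>)\<bar> \<le> 2 * K * \<bar>y\<bar>"
        using nneg False K \<open>R > 0\<close> assms(3) by (intro mult_left_mono) auto
      then show ?thesis using err[of N] by linarith
    qed
    have "\<bar>y\<bar> \<le> \<bar>y\<bar> powr q / B"
    proof -
      have "B = R powr (q - 1)" using assms(1,2) by (simp add: R powr_powr)
      also have "\<dots> \<le> \<bar>y\<bar> powr (q - 1)"
        using False \<open>R > 0\<close> assms(1) by (intro powr_mono2) auto
      finally have "\<bar>y\<bar> * B \<le> \<bar>y\<bar> * \<bar>y\<bar> powr (q - 1)" by (simp add: mult_left_mono)
      also have "\<dots> = \<bar>y\<bar> powr q"
        using False \<open>R > 0\<close> by (simp add: powr_mult_base)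
      finally show ?thesis using assms(2) by (simp add: field_simps)
    qed
    note err_abs
    also have "2 * K * \<bar>y\<bar> \<le> 2 * K * (\<bar>y\<bar> powr q / B)"
      using K \<open>\<bar>y\<bar> \<le> \<bar>y\<bar> powr q / B\<close> by (intro mult_left_mono) auto
    also have "\<dots> \<le> 2 * K / B * (1 + \<bar>y\<bar> powr q)"
      using K assms(2) by (simp add: field_simps)
    finally show ?thesis .
  qed
qed

section \<open>Networks with one hidden layer\<close>

lemma one_hidden_layer:
  assumes "1 \<le> d" "L \<noteq> []" "\<And>i a t. (i, a, t) \<in> set L \<Longrightarrow> i < d"
  obtains \<phi> where "\<phi> \<in> skeletons" "in_dim \<phi> = d" "out_dim \<phi> = 1"
    "num_params \<phi> = length L * (d + 2) + 1"
    "\<forall>x\<in>carrier_vec d.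
      realization ReLU \<phi> x $ 0 = c + (\<Sum>(i, a, t)\<leftarrow>L. a * ReLU (x $ i - t))"
proof
  define m where "m = length L"
  have m: "1 \<le> m" using assms(2) by (cases L) (auto simp: m_def)
  \<comment> \<open>A triple \<open>(i, a, t)\<close> becomes one hidden neuron: its row of
    \<open>V\<close> selects coordinate \<open>i\<close>, its bias is \<open>-t\<close>, its output
    weight is \<open>a\<close>. It costs d + 1 parameters in the first layer and one in the second;
    the final 1 in the count is the output bias \<open>c\<close>.\<close>
  define V where "V = mat m d (\<lambda>(r, j). if j = fst (L ! r) then 1 else (0::real))"
  define b where "b = vec m (\<lambda>r. - snd (snd (L ! r)))"
  define W where "W = mat 1 m (\<lambda>(_, r). fst (snd (L ! r)))"
  define \<phi> where "\<phi> = [(V, b), (W, vec 1 (\<lambda>_. c))]"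
  show "\<phi> \<in> skeletons"
    using m assms(1) by (simp add: skeletons_def \<phi>_def V_def b_def W_def)
  show "in_dim \<phi> = d" "out_dim \<phi> = 1" "num_params \<phi> = length L * (d + 2) + 1"
    by (simp_all add: in_dim_def out_dim_def num_params_def \<phi>_def V_def W_def m_def)
  show "\<forall>x\<in>carrier_vec d. realization ReLU \<phi> x $ 0 = c + (\<Sum>(i, a, t)\<leftarrow>L. a * ReLU (x $ i - t))"
  proof
    fix x :: "real vec"
    assume x: "x \<in> carrier_vec d"
    have hidden: "(V *\<^sub>v x + b) $ r = x $ fst (L ! r) - snd (snd (L ! r))" if "r < m" for r
    proof -
      have "fst (L ! r) < d"
        using assms(3)[of "fst (L ! r)" "fst (snd (L ! r))" "snd (snd (L ! r))"] that by (simp add: m_def)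
      then have "(\<Sum>j = 0..<d. (if j = fst (L ! r) then 1 else 0) * x $ j) = x $ fst (L ! r)"
        by (subst sum.cong[OF refl, of _ _ "\<lambda>j. if j = fst (L ! r) then x $ j else 0"]) auto
      then show ?thesis
        using that x by (simp add: V_def b_def scalar_prod_def)
    qed
    have dim: "dim_vec (V *\<^sub>v x + b) = m" by (simp add: b_def)
    have "realization ReLU \<phi> x $ 0
        = c + (\<Sum>r = 0..<m. fst (snd (L ! r)) * ReLU (x $ fst (L ! r) - snd (snd (L ! r))))"
    proof -
      define y where "y = V *\<^sub>v x + b"
      have "realization ReLU \<phi> x $ 0 = (\<Sum>r = 0..<m. fst (snd (L ! r)) * ReLU (y $ r)) + c"
        using dim by (simp add: \<phi>_def W_def scalar_prod_def flip: y_def)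
      then show ?thesis using hidden by (simp add: y_def)
    qed
    also have "\<dots> = c + (\<Sum>(i, a, t)\<leftarrow>L. a * ReLU (x $ i - t))"
      by (simp add: sum_list_sum_nth m_def case_prod_beta)
    finally show "realization ReLU \<phi> x $ 0 = c + (\<Sum>(i, a, t)\<leftarrow>L. a * ReLU (x $ i - t))" .
  qed
qed

lemma sum_list_map_concat_upt:
  "sum_list (map g (concat (map f [0..<n]))) = (\<Sum>i<n. sum_list (map g (f i)))"
  for g :: "'a \<Rightarrow> 'b::comm_monoid_add"
  by (induction n) auto

text \<open>A ramp needs two neurons, so \<open>d\<close> interpolants with \<open>N\<close>
  intervals each need 2Nd of them. The values at the left grid end are collected in the output
  bias.\<close>

lemma interpolant_network:
  assumes "1 \<le> d" "1 \<le> N"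
  obtains \<phi> where "\<phi> \<in> skeletons" "in_dim \<phi> = d" "out_dim \<phi> = 1"
    "num_params \<phi> = 2 * N * d * (d + 2) + 1"
    "\<forall>x\<in>carrier_vec d.
      realization ReLU \<phi> x $ 0 = coord_sum (\<lambda>i. interpolant (f i) a \<delta> N) d x"
proof -
  let ?t = "\<lambda>j. a + real j * \<delta>"
  \<comment> \<open>Coordinates count from 0 but the family \<open>f\<close> from 1, hence
    \<open>f (Suc i)\<close>.\<close>
  define s where "s i j = (f (Suc i) (?t (Suc j)) - f (Suc i) (?t j)) / \<delta>" for i j
  define L where "L = concat (map (\<lambda>i. concat (map (\<lambda>j.
    [(i, s i j, ?t j), (i, - s i j, ?t (Suc j))]) [0..<N])) [0..<d])"
  have len: "length L = 2 * N * d"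
    by (simp add: L_def length_concat comp_def sum_list_triv)
  have "L \<noteq> []" using len assms by (intro notI) simp
  moreover have "\<And>i b t. (i, b, t) \<in> set L \<Longrightarrow> i < d"
    by (auto simp: L_def)
  ultimately obtain \<phi> where \<phi>: "\<phi> \<in> skeletons" "in_dim \<phi> = d" "out_dim \<phi> = 1"
    "num_params \<phi> = length L * (d + 2) + 1"
    "\<forall>x\<in>carrier_vec d. realization ReLU \<phi> x $ 0
      = (\<Sum>i = 1..d. f i a) + (\<Sum>(i, a, t)\<leftarrow>L. a * ReLU (x $ i - t))"
    by (rule one_hidden_layer[OF assms(1)])
  have "realization ReLU \<phi> x $ 0 = coord_sum (\<lambda>i. interpolant (f i) a \<delta> N) d x"
    if "x \<in> carrier_vec d" for x
  proof -
    have "(\<Sum>(i, a, t)\<leftarrow>L. a * ReLU (x $ i - t)) = (\<Sum>i<d. \<Sum>j<N.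
        s i j * (ReLU (x $ i - ?t j) - ReLU (x $ i - ?t (Suc j))))"
      unfolding L_def
      by (simp add: sum_list_map_concat_upt right_diff_distrib del: of_nat_Suc)
    then show ?thesis
      by (simp add: \<phi>(5)[rule_format, OF that] coord_sum_def interpolant_def s_def sum.distrib sum.atLeast1_atMost_eq
        del: of_nat_Suc)
  qed
  then show thesis using \<phi>(1-4) len by (intro that[of \<phi>]) auto
qed

section \<open>From single coordinates to the Euclidean norm\<close>

lemma sum_abs_le_sqrt_mult_eucl_norm:
  "(\<Sum>i = 0..<dim_vec x. \<bar>x $ i\<bar>) \<le> sqrt (real (dim_vec x)) * eucl_norm x"
  using L2_set_mult_ineq[of "\<lambda>i. x $ i" "\<lambda>_. 1" "{0..<dim_vec x}"]
  by (simp add: eucl_norm_def L2_set_constant mult.commute)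

lemma abs_index_le_eucl_norm: "i < dim_vec x \<Longrightarrow> \<bar>x $ i\<bar> \<le> eucl_norm x"
  using member_le_L2_set[of "{0..<dim_vec x}" i "\<lambda>i. \<bar>x $ i\<bar>"]
  by (simp add: eucl_norm_def L2_set_def)

text \<open>Coordinatewise bounds give the constant \<open>K\<close> for the l1 norm; Cauchy-Schwarz
  against the all-ones vector turns this into the factor sqrt d for the Euclidean norm.\<close>

lemma eucl_lipschitz_coord_sum:
  assumes "0 \<le> K" "\<And>i y z. 1 \<le> i \<Longrightarrow> \<bar>h i y - h i z\<bar> \<le> K * \<bar>y - z\<bar>"
  shows "eucl_lipschitz (sqrt (real d) * K) d (coord_sum h d)"
  unfolding eucl_lipschitz_def
proof (intro conjI ballI)
  show "0 \<le> sqrt (real d) * K" using assms(1) by simp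
  fix x y :: "real vec"
  assume xy: "x \<in> carrier_vec d" "y \<in> carrier_vec d"
  have "\<bar>coord_sum h d x - coord_sum h d y\<bar>
      \<le> (\<Sum>i = 1..d. \<bar>h i (x $ (i - 1)) - h i (y $ (i - 1))\<bar>)"
    unfolding coord_sum_def sum_subtractf[symmetric] by (rule sum_abs)
  also have "\<dots> \<le> (\<Sum>i = 1..d. K * \<bar>x $ (i - 1) - y $ (i - 1)\<bar>)"
    using assms(2) by (intro sum_mono) auto
  also have "\<dots> = K * (\<Sum>i = 0..<dim_vec (x - y). \<bar>(x - y) $ i\<bar>)"
    using xy by (simp add: sum_distrib_left sum.atLeast1_atMost_eq atLeast0LessThan)
  also have "\<dots> \<le> K * (sqrt (real (dim_vec (x - y))) * eucl_norm (x - y))"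
    using assms(1) by (intro mult_left_mono sum_abs_le_sqrt_mult_eucl_norm)
  also have "\<dots> = sqrt (real d) * K * eucl_norm (x - y)"
    using xy by simp
  finally show "\<bar>coord_sum h d x - coord_sum h d y\<bar> \<le> sqrt (real d) * K * eucl_norm (x - y)" .
qed

text \<open>Each |x_i| is at most the norm of \<open>x\<close>, so every coordinate weight is
  bounded by the common one. The \<open>d\<close> summands produce the factor \<open>d\<close>,
  which is why each coordinate is approximated to accuracy \<epsilon>/d.\<close>

lemma coord_sum_error:
  assumes "1 \<le> d" "x \<in> carrier_vec d" "0 \<le> q" "0 \<le> c"
    and "\<And>i y. 1 \<le> i \<Longrightarrow> \<bar>g i y - h i y\<bar> \<le> c * (1 + \<bar>y\<bar> powr q)"
  shows "\<bar>coord_sum g d x - coord_sum h d x\<bar> \<le> real d * c * (1 + eucl_norm x powr q)"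
proof -
  have "\<bar>coord_sum g d x - coord_sum h d x\<bar>
      \<le> (\<Sum>i = 1..d. \<bar>g i (x $ (i - 1)) - h i (x $ (i - 1))\<bar>)"
    unfolding coord_sum_def sum_subtractf[symmetric] by (rule sum_abs)
  also have "\<dots> \<le> (\<Sum>i = 1..d. c * (1 + eucl_norm x powr q))"
  proof (rule sum_mono)
    fix i assume i: "i \<in> {1..d}"
    then have "\<bar>x $ (i - 1)\<bar> \<le> eucl_norm x"
      using assms(2) by (intro abs_index_le_eucl_norm) auto
    then have "\<bar>x $ (i - 1)\<bar> powr q \<le> eucl_norm x powr q"
      using assms(3) by (intro powr_mono2) auto
    then have "c * (1 + \<bar>x $ (i - 1)\<bar> powr q) \<le> c * (1 + eucl_norm x powr q)"
      using assms(4) by (intro mult_left_mono) auto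
    then show "\<bar>g i (x $ (i - 1)) - h i (x $ (i - 1))\<bar> \<le> c * (1 + eucl_norm x powr q)"
      using assms(5)[of i "x $ (i - 1)"] i by simp
  qed
  finally show ?thesis by simp
qed

section \<open>The parameter count\<close>

lemma param_bound:
  fixes d N :: nat and q K \<epsilon> t :: real
  assumes "1 \<le> d" "1 < q" "1 \<le> K" "0 < \<epsilon>" "0 < t" "1 \<le> N"
    and N: "real N \<le> 3 * (2 * K * real d / \<epsilon>) powr t"
  shows "real (2 * N * d * (d + 2) + 1) \<le> 2 / 9 * 10 ^ 3 * 2 powr (3 * t * (q + 1))
    * K powr (2 * t * (q + 1)) * real d powr (t * (q + 1) + 4) * \<epsilon> powr (- t)"
proof -
  \<comment> \<open>Absorb the lower-order terms using 1 \<le> N d \<le> N d^2: the coefficients 2,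
    4 and 1 add up to 7.\<close>
  have "2 * N * d * (d + 2) + 1 \<le> 7 * (d * d) * N"
  proof -
    have "1 * 1 \<le> N * d" using assms(1,6) by (intro mult_le_mono)
    moreover have "N * d * 1 \<le> N * d * d" using assms(1) by (intro mult_le_mono) auto
    ultimately have "2 * (N * d * d) + 4 * (N * d) + 1 \<le> 7 * (N * d * d)" by linarith
    then show ?thesis by (simp only: algebra_simps)
  qed
  then have "real (2 * N * d * (d + 2) + 1) \<le> real (7 * (d * d) * N)"
    by (rule of_nat_mono)
  also have "\<dots> \<le> 7 * (real d * real d) * (3 * (2 * K * real d / \<epsilon>) powr t)"
    using mult_left_mono[OF N, of "7 * (real d * real d)"] by simp
  also have "\<dots> = 21 * 2 powr t * K powr t * real d powr (t + 2) * \<epsilon> powr (- t)"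
    using assms by (simp add: powr_mult powr_divide powr_add powr_minus_divide power2_eq_square)
  \<comment> \<open>Factor by factor: 21 < 2000/9, the bases 2, \<open>K\<close> and
    \<open>d\<close> are at least 1 and their exponents only grow, and the power of \<epsilon> is
    unchanged.\<close>
  also have "\<dots> \<le> (2 / 9 * 10 ^ 3) * 2 powr (3 * t * (q + 1))
    * K powr (2 * t * (q + 1)) * real d powr (t * (q + 1) + 4) * \<epsilon> powr (- t)"
  proof -
    have "0 < t * q" using assms by simp
    then have e: "t \<le> 3 * t * (q + 1)" "t \<le> 2 * t * (q + 1)" "t + 2 \<le> t * (q + 1) + 4"
      using assms(5) by (simp_all add: algebra_simps)
    show ?thesis
      using assms e by (intro mult_right_mono mult_mono powr_mono) auto
  qed
  finally show ?thesis .
qed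

section \<open>Choice of the grid and assembly\<close>

theorem proposition31:
  fixes q K :: real and f :: "nat \<Rightarrow> real \<Rightarrow> real"
  assumes "1 < q" and "1 \<le> K"
    and "\<And>i. i \<ge> 1 \<Longrightarrow> K-lipschitz_on UNIV (f i)"
    and "\<And>i. i \<ge> 1 \<Longrightarrow> \<bar>f i 0\<bar> \<le> K"
  shows "\<forall>d\<ge>1. \<forall>\<epsilon>\<in>{0<..1}.
    \<exists>\<phi>\<in>skeletons. in_dim \<phi> = d \<and> out_dim \<phi> = 1 \<and>
      (SUP x\<in>carrier_vec d.
         ereal (inverse (1 + eucl_norm x powr q) * \<bar>coord_sum f d x - realization ReLU \<phi> x $ 0\<bar>))
        \<le> ereal \<epsilon> \<and>
      eucl_lipschitz (sqrt (real d) * K) d (\<lambda>x. realization ReLU \<phi> x $ 0) \<and>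
      (let t = q / (q - 1) in
        real (num_params \<phi>) \<le> 2 / 9 * 10 ^ 3 * 2 powr (3 * t * (q + 1)) * K powr (2 * t * (q + 1))
          * real d powr (t * (q + 1) + 4) * \<epsilon> powr (- t))"
proof (intro allI impI ballI)
  fix d :: nat and \<epsilon> :: real
  assume d: "1 \<le> d" and "\<epsilon> \<in> {0<..1}"
  then have eps: "0 < \<epsilon>" "\<epsilon> \<le> 1" by auto
  define t where "t = q / (q - 1)"
  \<comment> \<open>Chosen so that d * (2K/B) = \<epsilon>, the total of the \<open>d\<close>
    coordinate errors.\<close>
  define B where "B = 2 * K * real d / \<epsilon>"
  define R where "R = B powr (1 / (q - 1))"
  \<comment> \<open>Since 1/(q-1) + 1 = t, R * B equals B^t, so this is the least \<open>N\<close>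
    with 2RB \<le> N.\<close>
  define N where "N = nat \<lceil>2 * B powr t\<rceil>"
  define h where "h = (\<lambda>i. interpolant (f i) (- R) (2 * R / real N) N)"
  have t: "0 < t" using assms(1) by (simp add: t_def)
  have "1 * 1 \<le> K * real d" using d assms(2) by (intro mult_mono) auto
  then have B: "1 \<le> B" using eps by (simp add: B_def field_simps)
  then have Bt: "1 \<le> B powr t" using t by (intro ge_one_powr_ge_zero) auto
  \<comment> \<open>Rounding up costs at most 1 \<le> B^t, hence the constant 3.\<close>
  have N: "1 \<le> N" "2 * B powr t \<le> real N" "real N \<le> 3 * B powr t"
    using Bt unfolding N_def by linarith+
  have "R * B = B powr (1 / (q - 1) + 1)"
    using B by (simp add: R_def powr_add)
  also have "1 / (q - 1) + 1 = t" using assms(1) by (simp add: t_def field_simps)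
  finally have RB: "2 * R * B \<le> real N" using N(2) by simp
  have R: "0 < R" using B by (simp add: R_def)
  obtain \<phi> where \<phi>: "\<phi> \<in> skeletons" "in_dim \<phi> = d" "out_dim \<phi> = 1"
    "num_params \<phi> = 2 * N * d * (d + 2) + 1"
    "\<forall>x\<in>carrier_vec d. realization ReLU \<phi> x $ 0 = coord_sum h d x"
    unfolding h_def by (rule interpolant_network[OF d N(1), of f "- R" "2 * R / real N"])
  have "(SUP x\<in>carrier_vec d.
      ereal (inverse (1 + eucl_norm x powr q) * \<bar>coord_sum f d x - realization ReLU \<phi> x $ 0\<bar>))
      \<le> ereal \<epsilon>"
  \<comment> \<open>The supremum is taken in the extended reals, so bounding every member suffices
    and no boundedness has to be shown first.\<close>
  proof (rule SUP_least)
    fix x :: "real vec"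
    assume x: "x \<in> carrier_vec d"
    have "\<bar>coord_sum f d x - coord_sum h d x\<bar> \<le> real d * (2 * K / B) * (1 + eucl_norm x powr q)"
    proof (rule coord_sum_error[OF d x])
      show "\<bar>f i y - h i y\<bar> \<le> 2 * K / B * (1 + \<bar>y\<bar> powr q)" if "1 \<le> i" for i y
        unfolding h_def using assms(1) B N(1) assms(3)[OF that] R_def RB
        by (intro interpolant_error_weighted) auto
    qed (use assms(1,2) B in auto)
    also have "real d * (2 * K / B) = \<epsilon>"
      using d assms(2) eps by (simp add: B_def field_simps)
    finally have "\<bar>coord_sum f d x - realization ReLU \<phi> x $ 0\<bar> \<le> \<epsilon> * (1 + eucl_norm x powr q)"
      by (simp add: \<phi>(5)[rule_format, OF x])
    moreover have "0 < 1 + eucl_norm x powr q"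
      by (simp add: add_pos_nonneg)
    ultimately show "ereal (inverse (1 + eucl_norm x powr q) *
        \<bar>coord_sum f d x - realization ReLU \<phi> x $ 0\<bar>) \<le> ereal \<epsilon>"
      by (simp add: field_simps)
  qed
  \<comment> \<open>The Lipschitz bound is shown for the sum of interpolants and carries over
    because the realization agrees with it on \<open>carrier_vec d\<close>.\<close>
  moreover have "eucl_lipschitz (sqrt (real d) * K) d (coord_sum h d)"
    unfolding h_def using assms(2,3) R N(1)
    by (intro eucl_lipschitz_coord_sum interpolant_lipschitz) auto
  then have "eucl_lipschitz (sqrt (real d) * K) d (\<lambda>x. realization ReLU \<phi> x $ 0)"
    by (simp add: eucl_lipschitz_def \<phi>(5))
  moreover have "real (num_params \<phi>) \<le> 2 / 9 * 10 ^ 3 * 2 powr (3 * t * (q + 1))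
      * K powr (2 * t * (q + 1)) * real d powr (t * (q + 1) + 4) * \<epsilon> powr (- t)"
    unfolding \<phi>(4) using d assms(1,2) eps(1) t N(1) N(3)[unfolded B_def] by (rule param_bound)
  ultimately show "\<exists>\<phi>\<in>skeletons. in_dim \<phi> = d \<and> out_dim \<phi> = 1 \<and>
      (SUP x\<in>carrier_vec d.
         ereal (inverse (1 + eucl_norm x powr q) * \<bar>coord_sum f d x - realization ReLU \<phi> x $ 0\<bar>))
        \<le> ereal \<epsilon> \<and>
      eucl_lipschitz (sqrt (real d) * K) d (\<lambda>x. realization ReLU \<phi> x $ 0) \<and>
      (let t = q / (q - 1) in
        real (num_params \<phi>) \<le> 2 / 9 * 10 ^ 3 * 2 powr (3 * t * (q + 1)) * K powr (2 * t * (q + 1))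
          * real d powr (t * (q + 1) + 4) * \<epsilon> powr (- t))"
    using \<phi>(1-3) unfolding Let_def t_def[symmetric] by blast
qed

end
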